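(* Let $\lambda=(r,h):S^1\to\mathbb{R}^2$ be a smooth embedding such that $r(s)>0$ for all $s\in S^1$, and let $\mathcal{K}=\lambda(S^1)$. Then for any compact set $B\subseteq\mathbb{R}^2$ containing $\mathcal{K}$ in its interior, there is an admissible perturbation $\alpha$ for $\mathcal{K}$ supported in $B$ such that the surface of revolution $\mathcal{F}(\bar\alpha(1)\circ\lambda)$ admits a nontrivial infinitesimal deformation.
   Context: $S^1$ is identified with $\mathbb{R}/2\pi\mathbb{Z}$. For a smooth map $\mu=(r,h):S^1\to\mathbb{R}^2$ with $r>0$, the surface of revolution $\mathcal{F}(\mu)$ is the map $F:S^1\times\mathbb{R}\to\mathbb{R}^3$, $F(s,t)=r(s)(\cos t,\sin t,0)+h(s)(0,0,1)$. An infinitesimal deformation of $F$ is a smooth map $Z:S^1\times\mathbb{R}\to\mathbb{R}^3$, $2\pi$-periodic in $t$, such that $\mathrm{d}Z(X)\bullet\mathrm{d}F(X)=0$ for every tangent vector $X$, equivalently $\partial_sZ\bullet\partial_sF=0$, $\partial_tZ\bullet\partial_tF=0$, $\partial_tZ\bullet\partial_sF+\partial_sZ\bullet\partial_tF=0$ ($\bullet$ the dot product). It is trivial if it is of the form $Z(s,t)=\mu\times F(s,t)+\omega$ for constants $\mu,\omega\in\mathbb{R}^3$ (those arising from bendings by rigid motions), and nontrivial otherwise. An isotopy of $\mathbb{R}^2$ is a $C^3$ map $\alpha:[0,1]\times\mathbb{R}^2\to\mathbb{R}^2$ such that each $\bar\alpha(t):p\mapsto\alpha(t,p)$ is a $C^3$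 homeomorphism and $\bar\alpha(0)=\mathrm{Id}$. For $\mathcal{K}\subseteq\{(x,z):x>0\}$, an isotopy $\alpha$ is an admissible perturbation for $\mathcal{K}$ if $\bar\alpha(t)(\mathcal{K})\subseteq\{(x,z):x>0\}$ for all $t\in[0,1]$. The support of a map $G:\mathbb{R}^2\to\mathbb{R}^2$ is the closure of $\{p:G(p)\neq p\}$; the support of the isotopy $\alpha$ is the closure of the union over $t\in[0,1]$ of the supports of $\bar\alpha(t)$. *)

theory Defs
  imports "HOL-Analysis.Analysis"
begin

fun Ck_on :: "nat \<Rightarrow> 'a::euclidean_space set \<Rightarrow> ('a \<Rightarrow> 'b::real_normed_vector) \<Rightarrow> bool" where
  "Ck_on 0 S f = continuous_on S f"
| "Ck_on (Suc k) S f =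
     ((\<forall>x\<in>S. f differentiable (at x within S)) \<and>
      (\<forall>v\<in>Basis. Ck_on k S (\<lambda>x. frechet_derivative f (at x within S) v)))"

definition smooth_on :: "'a::euclidean_space set \<Rightarrow> ('a \<Rightarrow> 'b::real_normed_vector) \<Rightarrow> bool" where
  "smooth_on S f \<longleftrightarrow> (\<forall>k. Ck_on k S f)"

(* A smooth embedding S^1 = R/2piZ -> R^2, represented as a 2pi-periodic map R -> R^2:
   smooth, periodic, injective on one period, and an immersion. *)
definition smooth_embedding_S1 :: "(real \<Rightarrow> real \<times> real) \<Rightarrow> bool" where
  "smooth_embedding_S1 l \<longleftrightarrow>
     smooth_on UNIV l \<and>
     (\<forall>s. l (s + 2*pi) = l s) \<and>
     inj_on l {0..<2*pi} \<and>
     (\<forall>s. frechet_derivative l (at s) 1 \<noteq> 0)"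

definition surf_rev :: "(real \<Rightarrow> real \<times> real) \<Rightarrow> real \<times> real \<Rightarrow> real^3" where
  "surf_rev mu = (\<lambda>(s,t). vector [fst (mu s) * cos t, fst (mu s) * sin t, snd (mu s)])"

definition inf_deformation :: "(real \<times> real \<Rightarrow> real^3) \<Rightarrow> (real \<times> real \<Rightarrow> real^3) \<Rightarrow> bool" where
  "inf_deformation F Z \<longleftrightarrow>
     smooth_on UNIV Z \<and>
     (\<forall>s t. Z (s + 2*pi, t) = Z (s, t)) \<and>
     (\<forall>s t. Z (s, t + 2*pi) = Z (s, t)) \<and>
     (\<forall>p X. frechet_derivative Z (at p) X \<bullet> frechet_derivative F (at p) X = 0)"

definition trivial_deformation :: "(real \<times> real \<Rightarrow> real^3) \<Rightarrow> (real \<times> real \<Rightarrow> real^3) \<Rightarrow> bool" where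
  "trivial_deformation F Z \<longleftrightarrow> (\<exists>m w. \<forall>p. Z p = cross3 m (F p) + w)"

definition isotopy :: "(real \<times> (real \<times> real) \<Rightarrow> real \<times> real) \<Rightarrow> bool" where
  "isotopy a \<longleftrightarrow>
     Ck_on 3 ({0..1} \<times> UNIV) a \<and>
     (\<forall>t\<in>{0..1}. (\<exists>g. homeomorphism UNIV UNIV (\<lambda>p. a (t,p)) g) \<and>
                   Ck_on 3 UNIV (\<lambda>p. a (t,p))) \<and>
     (\<forall>p. a (0,p) = p)"

definition right_half_plane :: "(real \<times> real) set" where
  "right_half_plane = {q. fst q > 0}"

definition admissible_perturbation :: "(real \<times> (real \<times> real) \<Rightarrow> real \<times> real) \<Rightarrow> (real \<times> real) set \<Rightarrow> bool" where
  "admissible_perturbation a K \<longleftrightarrow>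
     isotopy a \<and> (\<forall>t\<in>{0..1}. (\<lambda>p. a (t,p)) ` K \<subseteq> right_half_plane)"

definition support_map :: "(real \<times> real \<Rightarrow> real \<times> real) \<Rightarrow> (real \<times> real) set" where
  "support_map G = closure {p. G p \<noteq> p}"

definition support_isotopy :: "(real \<times> (real \<times> real) \<Rightarrow> real \<times> real) \<Rightarrow> (real \<times> real) set" where
  "support_isotopy a = closure (\<Union>t\<in>{0..1}. support_map (\<lambda>p. a (t,p)))"

end

theory Submission
  imports Defs
begin

text \<open>
  Where the generating curve is horizontal, the surface of revolution contains a planar annulus,
  and any vertical field supported in that annulus is an infinitesimal deformation: the
  differential of the surface is horizontal there. It is nontrivial because it vanishes on a whole
  circle of latitude without vanishing identically. So it suffices to flatten a short arc of the
  curve. By Rolle's theorem the height has a critical point $s_0$, and near it the immersed curve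
  is a graph $z = g(x)$. With $c = g(x_0)$ and cutoffs $\eta$, $\zeta$, the vertical shear
  $(x, z) \mapsto (x, z - t\,\eta(x)(g(x) - c)\,\zeta(z - c))$ moves an arc of the graph to the
  line $z = c$ at $t = 1$. Since $g(x) - c$ is small near $x_0$ while the Lipschitz constant of
  $\zeta$ is fixed first, the shear is strictly increasing in $z$, hence a homeomorphism.
\<close>

section \<open>Calculus of \<open>C\<^sup>k\<close> maps\<close>

text \<open>On these sets Frechet derivatives within the set are unique, so the choice made by
  \<^const>\<open>frechet_derivative\<close> in \<^const>\<open>Ck_on\<close> is the expected derivative.\<close>

definition thick :: "'a::euclidean_space set \<Rightarrow> bool" where
  "thick S \<longleftrightarrow> (\<forall>x\<in>S. \<forall>i\<in>Basis. \<forall>e>0. \<exists>d. 0 < \<bar>d\<bar> \<and> \<bar>d\<bar> < e \<and> x + d *\<^sub>R i \<in> S)"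

lemma thick_open:
  assumes "open S"
  shows "thick S"
  unfolding thick_def
proof (intro ballI allI impI)
  fix x i :: 'a and e :: real
  assume x: "x \<in> S" and i: "i \<in> Basis" and e: "e > 0"
  obtain r where r: "r > 0" "ball x r \<subseteq> S"
    using assms x open_contains_ball by blast
  define d where "d = min r e / 2"
  have "x + d *\<^sub>R i \<in> ball x r"
    using i r e by (auto simp: dist_norm d_def)
  then show "\<exists>d. 0 < \<bar>d\<bar> \<and> \<bar>d\<bar> < e \<and> x + d *\<^sub>R i \<in> S"
    using r e by (intro exI[of _ d]) (auto simp: d_def)
qed

lemma thick_UNIV [simp]: "thick UNIV"
  by (simp add: thick_open)

text \<open>A basis vector of the product lies in one factor, so the small step is taken there. This
  covers the domain [0,1] x R^2 of an isotopy.\<close>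

lemma thick_Times:
  assumes "thick S" "thick T"
  shows "thick (S \<times> T)"
  unfolding thick_def
proof (intro ballI allI impI)
  fix p i :: "'a \<times> 'b" and e :: real
  assume p: "p \<in> S \<times> T" and i: "i \<in> Basis" and e: "e > 0"
  from i consider u where "u \<in> Basis" "i = (u, 0)" | v where "v \<in> Basis" "i = (0, v)"
    by (auto simp: Basis_prod_def)
  then show "\<exists>d. 0 < \<bar>d\<bar> \<and> \<bar>d\<bar> < e \<and> p + d *\<^sub>R i \<in> S \<times> T"
  proof cases
    case 1
    then obtain d where "0 < \<bar>d\<bar>" "\<bar>d\<bar> < e" "fst p + d *\<^sub>R u \<in> S"
      using assms(1) p e unfolding thick_def by (metis mem_Times_iff)
    then show ?thesis
      using p 1 by (intro exI[of _ d]) (auto simp: mem_Times_iff)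
  next
    case 2
    then obtain d where "0 < \<bar>d\<bar>" "\<bar>d\<bar> < e" "snd p + d *\<^sub>R v \<in> T"
      using assms(2) p e unfolding thick_def by (metis mem_Times_iff)
    then show ?thesis
      using p 2 by (intro exI[of _ d]) (auto simp: mem_Times_iff)
  qed
qed

lemma thick_Icc:
  fixes a b :: real
  assumes "a < b"
  shows "thick {a..b}"
  unfolding thick_def
proof (intro ballI allI impI)
  fix x i e :: real
  assume x: "x \<in> {a..b}" and i: "i \<in> Basis" and e: "e > 0"
  show "\<exists>d. 0 < \<bar>d\<bar> \<and> \<bar>d\<bar> < e \<and> x + d *\<^sub>R i \<in> {a..b}"
  proof (cases "x < b")
    case True
    then show ?thesis
      using x i e by (intro exI[of _ "min (b - x) (e / 2)"]) auto
  next
    case False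
    then show ?thesis
      \<comment> \<open>Here x = b, so the step goes to the left; capping it by b - a keeps it
        inside the interval.\<close>
      using x i e assms by (intro exI[of _ "- min (b - a) (e / 2)"]) auto
  qed
qed

lemma frechet_derivative_within_eq:
  assumes "thick S" "x \<in> S" "(f has_derivative f') (at x within S)"
  shows "frechet_derivative f (at x within S) = f'"
proof (rule frechet_derivative_unique_within)
  show "(f has_derivative frechet_derivative f (at x within S)) (at x within S)"
    using assms(3) differentiable_def frechet_derivative_works by blast
qed (use assms in \<open>auto simp: thick_def\<close>)

text \<open>The derivative within S sees only values on S, and on a thick set it is unique. Hence
  the derivatives of f and g agree on S as well, and the induction continues with them.\<close>

lemma Ck_on_cong:
  assumes "Ck_on k S f" "\<And>x. x \<in> S \<Longrightarrow> f x = g x" "thick S"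
  shows "Ck_on k S g"
  using assms(1,2)
proof (induction k arbitrary: f g)
  case 0
  then show ?case
    using continuous_on_eq by auto
next
  case (Suc k)
  have der: "(g has_derivative frechet_derivative f (at x within S)) (at x within S)"
    if "x \<in> S" for x
  proof (rule has_derivative_transform[OF that])
    show "(f has_derivative frechet_derivative f (at x within S)) (at x within S)"
      using Suc.prems(1) that by (auto simp: frechet_derivative_works)
  qed (use Suc.prems(2) in simp)
  have eq: "frechet_derivative f (at x within S) = frechet_derivative g (at x within S)"
    if "x \<in> S" for x
    using that assms(3) frechet_derivative_within_eq der by metis
  have "Ck_on k S (\<lambda>x. frechet_derivative g (at x within S) v)" if "v \<in> Basis" for v
  proof (rule Suc.IH)
    show "Ck_on k S (\<lambda>x. frechet_derivative f (at x within S) v)"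
      using Suc.prems(1) that by simp
  qed (simp add: eq)
  then show ?case
    using der by (auto simp: differentiable_def)
qed

text \<open>Any explicit derivative may replace the one chosen by \<open>frechet_derivative\<close>.
  With \<open>Ck_on_SucD\<close> for the converse, later inductions can work with the usual
  differentiation rules.\<close>

lemma Ck_on_SucI:
  assumes "thick S"
    and "\<And>x. x \<in> S \<Longrightarrow> (f has_derivative f' x) (at x within S)"
    and "\<And>v. v \<in> Basis \<Longrightarrow> Ck_on k S (\<lambda>x. f' x v)"
  shows "Ck_on (Suc k) S f"
proof -
  have "Ck_on k S (\<lambda>x. frechet_derivative f (at x within S) v)" if "v \<in> Basis" for v
    by (rule Ck_on_cong[OF assms(3)[OF that] _ assms(1)])
      (metis assms(1,2) frechet_derivative_within_eq)
  then show ?thesis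
    using assms(2) by (auto simp: differentiable_def)
qed

lemma Ck_on_SucD:
  assumes "Ck_on (Suc k) S f"
  shows "\<exists>f'. (\<forall>x\<in>S. (f has_derivative f' x) (at x within S)) \<and>
    (\<forall>v\<in>Basis. Ck_on k S (\<lambda>x. f' x v))"
  using assms by (intro exI[of _ "\<lambda>x. frechet_derivative f (at x within S)"])
    (simp add: frechet_derivative_works)

text \<open>A linear map on the reals is determined by its value at 1, so in one variable a single
  derivative function carries all the information.\<close>

lemma Ck_on_Suc_real_iff:
  fixes f :: "real \<Rightarrow> 'b::real_normed_vector"
  assumes "thick S"
  shows "Ck_on (Suc k) S f \<longleftrightarrow>
    (\<exists>f'. (\<forall>x\<in>S. (f has_vector_derivative f' x) (at x within S)) \<and> Ck_on k S f')"
proof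
  assume "Ck_on (Suc k) S f"
  then obtain f' where f': "\<forall>x\<in>S. (f has_derivative f' x) (at x within S)"
    "\<forall>v\<in>Basis. Ck_on k S (\<lambda>x. f' x v)"
    using Ck_on_SucD by blast
  have "f' x = (\<lambda>h. h *\<^sub>R f' x 1)" if "x \<in> S" for x
  proof
    have "linear (f' x)"
      using f'(1) that has_derivative_linear by blast
    then show "f' x h = h *\<^sub>R f' x 1" for h
      using linear_scale[of "f' x" h 1] by simp
  qed
  then have "\<forall>x\<in>S. (f has_derivative (\<lambda>h. h *\<^sub>R f' x 1)) (at x within S)"
    using f'(1) by simp
  then show "\<exists>f'. (\<forall>x\<in>S. (f has_vector_derivative f' x) (at x within S)) \<and> Ck_on k S f'"
    using f'(2) unfolding has_vector_derivative_def by (intro exI[of _ "\<lambda>x. f' x 1"]) simp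
next
  assume "\<exists>f'. (\<forall>x\<in>S. (f has_vector_derivative f' x) (at x within S)) \<and> Ck_on k S f'"
  then obtain f' where f': "\<forall>x\<in>S. (f has_derivative (\<lambda>h. h *\<^sub>R f' x)) (at x within S)"
    "Ck_on k S f'"
    unfolding has_vector_derivative_def by blast
  show "Ck_on (Suc k) S f"
    by (rule Ck_on_SucI[OF assms, where f' = "\<lambda>x h. h *\<^sub>R f' x"]) (use f' in auto)
qed

lemma Ck_on_Suc_imp: "Ck_on (Suc k) S f \<Longrightarrow> Ck_on k S f"
proof (induction k arbitrary: f)
  case 0
  then show ?case
    using differentiable_imp_continuous_on differentiable_on_def by auto
qed auto

lemma Ck_on_imp_continuous_on: "Ck_on k S f \<Longrightarrow> continuous_on S f"
proof (induction k)
  case (Suc k)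
  then show ?case
    using Ck_on_Suc_imp by blast
qed simp

lemma Ck_on_subset:
  assumes "Ck_on k S f" "T \<subseteq> S" "thick T"
  shows "Ck_on k T f"
  using assms(1)
proof (induction k arbitrary: f)
  case 0
  then show ?case
    using assms continuous_on_subset by auto
next
  case (Suc k)
  obtain f' where "\<And>x. x \<in> S \<Longrightarrow> (f has_derivative f' x) (at x within S)"
    "\<And>v. v \<in> Basis \<Longrightarrow> Ck_on k S (\<lambda>x. f' x v)"
    using Ck_on_SucD[OF Suc.prems] by blast
  then show ?case
    using Suc.IH assms(2,3) by (intro Ck_on_SucI[of _ f f']) (blast intro: has_derivative_subset)+
qed

text \<open>On open sets the derivatives within U, within V and within the union are all the full
  derivative, so regularity is local. This serves to glue a function cut off inside U with its zero
  extension on V.\<close>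

lemma Ck_on_open_Un:
  assumes "open U" "open V" "Ck_on k U f" "Ck_on k V f"
  shows "Ck_on k (U \<union> V) f"
  using assms(3,4)
proof (induction k arbitrary: f)
  case 0
  then show ?case
    using assms by (simp add: continuous_on_open_Un)
next
  case (Suc k)
  have U: "at x within U = at x" if "x \<in> U" for x
    using at_within_open[OF that assms(1)] .
  have V: "at x within V = at x" if "x \<in> V" for x
    using at_within_open[OF that assms(2)] .
  have "Ck_on k (U \<union> V) (\<lambda>x. frechet_derivative f (at x) v)" if "v \<in> Basis" for v
  proof (rule Suc.IH)
    show "Ck_on k U (\<lambda>x. frechet_derivative f (at x) v)"
      by (rule Ck_on_cong[of k U "\<lambda>x. frechet_derivative f (at x within U) v"])
         (use Suc.prems(1) that in \<open>simp_all add: U thick_open assms(1)\<close>)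
    show "Ck_on k V (\<lambda>x. frechet_derivative f (at x) v)"
      by (rule Ck_on_cong[of k V "\<lambda>x. frechet_derivative f (at x within V) v"])
         (use Suc.prems(2) that in \<open>simp_all add: V thick_open assms(2)\<close>)
  qed
  moreover have "(f has_derivative frechet_derivative f (at x)) (at x within (U \<union> V))"
    if "x \<in> U \<union> V" for x
  proof -
    have "f differentiable (at x)"
      using that
    proof
      assume "x \<in> U"
      then show ?thesis
        using Suc.prems(1) U[of x] by auto
    next
      assume "x \<in> V"
      then show ?thesis
        using Suc.prems(2) V[of x] by auto
    qed
    then show ?thesis
      by (simp add: frechet_derivative_works has_derivative_at_withinI)
  qed
  ultimately show ?case
    by (intro Ck_on_SucI[where f' = "\<lambda>x. frechet_derivative f (at x)"] thick_open open_Un assms(1,2))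
qed

section \<open>Closure of C^k maps under algebra, composition and inversion\<close>

lemma Ck_on_const [simp]: "thick S \<Longrightarrow> Ck_on k S (\<lambda>x. c)"
proof (induction k arbitrary: c)
  case (Suc k)
  then show ?case
    by (intro Ck_on_SucI[where f' = "\<lambda>x h. 0"]) auto
qed auto

lemma Ck_on_bounded_linear:
  assumes "thick S" "bounded_linear L"
  shows "Ck_on k S L"
proof (cases k)
  case 0
  then show ?thesis
    using assms by (simp add: linear_continuous_on)
next
  case (Suc n)
  then show ?thesis
    using assms unfolding Suc
    by (intro Ck_on_SucI[where f' = "\<lambda>x. L"]) (auto intro: bounded_linear_imp_has_derivative)
qed

lemma Ck_on_ident: "thick S \<Longrightarrow> Ck_on k S (\<lambda>x. x)"
  by (simp add: Ck_on_bounded_linear bounded_linear_ident)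

lemma Ck_on_bounded_linear_compose:
  assumes "thick S" "bounded_linear L" "Ck_on k S f"
  shows "Ck_on k S (\<lambda>x. L (f x))"
  using assms(3)
proof (induction k arbitrary: f)
  case 0
  then show ?case
    using assms(2) by (simp add: bounded_linear.continuous_on)
next
  case (Suc k)
  obtain f' where f': "\<And>x. x \<in> S \<Longrightarrow> (f has_derivative f' x) (at x within S)"
    "\<And>v. v \<in> Basis \<Longrightarrow> Ck_on k S (\<lambda>x. f' x v)"
    using Ck_on_SucD[OF Suc.prems] by blast
  show ?case
    by (rule Ck_on_SucI[where f' = "\<lambda>x v. L (f' x v)"])
       (use f' Suc.IH assms in \<open>auto intro: bounded_linear.has_derivative\<close>)
qed

lemma Ck_on_add:
  assumes "thick S" "Ck_on k S f" "Ck_on k S g"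
  shows "Ck_on k S (\<lambda>x. f x + g x)"
  using assms(2,3)
proof (induction k arbitrary: f g)
  case 0
  then show ?case
    by (auto intro: continuous_on_add)
next
  case (Suc k)
  obtain f' where f': "\<And>x. x \<in> S \<Longrightarrow> (f has_derivative f' x) (at x within S)"
    "\<And>v. v \<in> Basis \<Longrightarrow> Ck_on k S (\<lambda>x. f' x v)"
    using Ck_on_SucD[OF Suc.prems(1)] by blast
  obtain g' where g': "\<And>x. x \<in> S \<Longrightarrow> (g has_derivative g' x) (at x within S)"
    "\<And>v. v \<in> Basis \<Longrightarrow> Ck_on k S (\<lambda>x. g' x v)"
    using Ck_on_SucD[OF Suc.prems(2)] by blast
  show ?case
    by (rule Ck_on_SucI[where f' = "\<lambda>x v. f' x v + g' x v"])
       (use f' g' Suc.IH assms(1) in \<open>auto intro: has_derivative_add\<close>)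
qed

lemma Ck_on_minus:
  assumes "thick S" "Ck_on k S f"
  shows "Ck_on k S (\<lambda>x. - f x)"
  using Ck_on_bounded_linear_compose[OF assms(1) bounded_linear_minus[OF bounded_linear_ident] assms(2)]
  by simp

lemma Ck_on_diff:
  assumes "thick S" "Ck_on k S f" "Ck_on k S g"
  shows "Ck_on k S (\<lambda>x. f x - g x)"
  using Ck_on_add[OF assms(1,2) Ck_on_minus[OF assms(1,3)]] by simp

lemma Ck_on_mult:
  fixes f g :: "'a::euclidean_space \<Rightarrow> real"
  assumes "thick S" "Ck_on k S f" "Ck_on k S g"
  shows "Ck_on k S (\<lambda>x. f x * g x)"
  using assms(2,3)
proof (induction k arbitrary: f g)
  case 0
  then show ?case
    by (auto intro: continuous_on_mult)
next
  case (Suc k)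
  obtain f' where f': "\<And>x. x \<in> S \<Longrightarrow> (f has_derivative f' x) (at x within S)"
    "\<And>v. v \<in> Basis \<Longrightarrow> Ck_on k S (\<lambda>x. f' x v)"
    using Ck_on_SucD[OF Suc.prems(1)] by blast
  obtain g' where g': "\<And>x. x \<in> S \<Longrightarrow> (g has_derivative g' x) (at x within S)"
    "\<And>v. v \<in> Basis \<Longrightarrow> Ck_on k S (\<lambda>x. g' x v)"
    using Ck_on_SucD[OF Suc.prems(2)] by blast
  show ?case
    by (rule Ck_on_SucI[where f' = "\<lambda>x v. f x * g' x v + f' x v * g x"])
       (use f' g' assms(1) Suc.prems[THEN Ck_on_Suc_imp] in \<open>auto intro!: has_derivative_mult Ck_on_add Suc.IH\<close>)
qed

text \<open>The pair is the sum of (f x, 0) and (0, g x), both images under bounded linear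
  maps.\<close>

lemma Ck_on_Pair:
  assumes "thick S" "Ck_on k S f" "Ck_on k S g"
  shows "Ck_on k S (\<lambda>x. (f x, g x))"
proof -
  have "bounded_linear (\<lambda>y::'b. (y, 0::'c))" "bounded_linear (\<lambda>y::'c. (0::'b, y))"
    by (auto intro!: bounded_linear_Pair bounded_linear_ident bounded_linear_zero)
  with assms have "Ck_on k S (\<lambda>x. (f x, 0) + (0, g x))"
    by (intro Ck_on_add) (auto intro: Ck_on_bounded_linear_compose)
  then show ?thesis
    by simp
qed

text \<open>With a scalar outer function the chain rule is a product of real functions. The
  induction hypothesis is applied to f' and the same g, which is also C^k, one order lower than
  given.\<close>

lemma Ck_on_compose:
  fixes f :: "real \<Rightarrow> real"
  assumes "thick S" "thick T" "Ck_on k T f" "Ck_on k S g" "g ` S \<subseteq> T"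
  shows "Ck_on k S (\<lambda>x. f (g x))"
  using assms(3,4)
proof (induction k arbitrary: f)
  case 0
  then show ?case
    using assms(5) by (auto intro: continuous_on_compose2)
next
  case (Suc k)
  obtain f' where f': "\<And>x. x \<in> T \<Longrightarrow> (f has_vector_derivative f' x) (at x within T)"
    "Ck_on k T f'"
    using Suc.prems(1) Ck_on_Suc_real_iff[OF assms(2)] by blast
  obtain g' where g': "\<And>x. x \<in> S \<Longrightarrow> (g has_derivative g' x) (at x within S)"
    "\<And>v. v \<in> Basis \<Longrightarrow> Ck_on k S (\<lambda>x. g' x v)"
    using Ck_on_SucD[OF Suc.prems(2)] by blast
  show ?case
  proof (rule Ck_on_SucI[where f' = "\<lambda>x v. g' x v * f' (g x)"])
    show "((\<lambda>x. f (g x)) has_derivative (\<lambda>v. g' x v * f' (g x))) (at x within S)" if "x \<in> S" for x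
      using has_derivative_in_compose2[of T f "\<lambda>y h. h * f' y" g S x "g' x"] f' g' assms(5) that
      by (auto simp: has_vector_derivative_def)
    show "Ck_on k S (\<lambda>x. g' x v * f' (g x))" if "v \<in> Basis" for v
      using that g' f' Suc.IH Suc.prems(2)[THEN Ck_on_Suc_imp] assms(1) by (intro Ck_on_mult) auto
  qed (use assms in auto)
qed

lemma Ck_on_compose_UNIV:
  fixes f :: "real \<Rightarrow> real"
  assumes "thick S" "Ck_on k UNIV f" "Ck_on k S g"
  shows "Ck_on k S (\<lambda>x. f (g x))"
  using Ck_on_compose[OF assms(1) thick_UNIV assms(2,3)] by simp

lemma Ck_on_inverse: "Ck_on k (- {0}) (inverse :: real \<Rightarrow> real)"
proof (induction k)
  case 0
  then show ?case
    by (simp add: continuous_on_inverse)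
next
  case (Suc k)
  have th: "thick (- {0::real})"
    by (intro thick_open) auto
  show ?case
    unfolding Ck_on_Suc_real_iff[OF th]
  proof (intro exI conjI ballI)
    fix x :: real
    assume "x \<in> - {0}"
    then show "(inverse has_vector_derivative - (inverse x * inverse x)) (at x within - {0})"
      using DERIV_inverse'[OF DERIV_ident, of x "- {0}"]
      by (simp add: has_real_derivative_iff_has_vector_derivative)
  next
    show "Ck_on k (- {0}) (\<lambda>x::real. - (inverse x * inverse x))"
      using Suc th by (intro Ck_on_minus Ck_on_mult)
  qed
qed

text \<open>The derivative of g is 1 / (f' o g). If g is C^k and f is C^(k+1), the right side is
  C^k, so g gains one order at each step, starting from continuity.\<close>

lemma Ck_on_inverse_function:
  fixes f g :: "real \<Rightarrow> real"
  assumes S: "open S" and T: "open T"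
    and f: "Ck_on k S f" "\<And>x. x \<in> S \<Longrightarrow> (f has_real_derivative f' x) (at x)"
    and f': "\<And>x. x \<in> S \<Longrightarrow> f' x \<noteq> 0"
    and g: "continuous_on T g" "g ` T \<subseteq> S" "\<And>y. y \<in> T \<Longrightarrow> f (g y) = y"
  shows "Ck_on k T g"
  using f(1)
proof (induction k)
  case 0
  then show ?case
    using g by simp
next
  case (Suc k)
  have thS: "thick S" and thT: "thick T" and th0: "thick (- {0::real})"
    using S T by (auto intro: thick_open)
  have gk: "Ck_on k T g"
    using Suc Ck_on_Suc_imp by blast
  obtain D where D: "\<And>x. x \<in> S \<Longrightarrow> (f has_vector_derivative D x) (at x within S)" "Ck_on k S D"
    using Suc.prems Ck_on_Suc_real_iff[OF thS] by blast
  have "D x = f' x" if "x \<in> S" for x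
    using D(1)[OF that] f(2)[OF that] that S
    by (metis DERIV_unique at_within_open has_real_derivative_iff_has_vector_derivative)
  then have f'k: "Ck_on k S f'"
    using Ck_on_cong[OF D(2) _ thS] by blast
  show ?case
    unfolding Ck_on_Suc_real_iff[OF thT]
  proof (intro exI conjI ballI)
    fix y assume y: "y \<in> T"
    have "DERIV g y :> inverse (f' (g y))"
      using y g f f' T by (intro has_field_derivative_inverse_basic[where t = T])
        (auto simp: continuous_on_eq_continuous_at)
    then show "(g has_vector_derivative inverse (f' (g y))) (at y within T)"
      using has_field_derivative_at_within has_real_derivative_iff_has_vector_derivative by blast
  next
    show "Ck_on k T (\<lambda>y. inverse (f' (g y)))"
    proof (rule Ck_on_compose[OF thT th0 Ck_on_inverse])
      show "Ck_on k T (\<lambda>y. f' (g y))"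
        by (rule Ck_on_compose[OF thT thS f'k gk g(2)])
    qed (use f' g(2) in auto)
  qed
qed

section \<open>Smooth cutoff functions\<close>

text \<open>Including the powers makes the family closed under differentiation, up to linear
  combinations.\<close>

definition flat :: "nat \<Rightarrow> real \<Rightarrow> real" where
  "flat n x = (if x > 0 then (1 / x) ^ n * exp (- (1 / x)) else 0)"

lemma flat_nonpos [simp]: "x \<le> 0 \<Longrightarrow> flat n x = 0"
  by (simp add: flat_def)

lemma flat_pos: "x > 0 \<Longrightarrow> flat n x > 0"
  by (simp add: flat_def)

lemma flat_nonneg: "flat n x \<ge> 0"
  by (simp add: flat_def)

lemma flat_0_mono: "x \<le> y \<Longrightarrow> flat 0 x \<le> flat 0 y"
  by (auto simp: flat_def field_simps)

text \<open>On the right of 0, the substitution y = 1/x turns the claim into y^n / exp y tending to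
  0 at infinity; on the left the function vanishes.\<close>

lemma flat_tendsto_0: "flat n \<midarrow>0\<rightarrow> 0"
proof -
  have "((\<lambda>y::real. y ^ n / exp y) \<longlongrightarrow> 0) at_top"
    by (rule tendsto_power_div_exp_0)
  then have "((\<lambda>x::real. (inverse x) ^ n / exp (inverse x)) \<longlongrightarrow> 0) (at_right 0)"
    by (rule filterlim_compose[OF _ filterlim_inverse_at_top_right])
  moreover have "\<forall>\<^sub>F x in at_right 0. inverse x ^ n / exp (inverse x) = flat n x"
    using eventually_at_right_less[of "0::real"]
    by eventually_elim (simp add: flat_def exp_minus divide_inverse)
  ultimately have "(flat n \<longlongrightarrow> 0) (at_right 0)"
    using Lim_transform_eventually by blast
  moreover have "(flat n \<longlongrightarrow> 0) (at_left 0)"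
  proof (rule Lim_transform_eventually)
    show "\<forall>\<^sub>F x in at_left 0. 0 = flat n x"
      by (auto simp: eventually_at_filter)
  qed auto
  ultimately show ?thesis
    by (simp add: filterlim_at_split)
qed

lemma DERIV_flat: "(flat n has_real_derivative flat (n + 2) x - n * flat (n + 1) x) (at x)"
proof (cases x "0::real" rule: linorder_cases)
  case less
  have "((\<lambda>x. 0) has_real_derivative 0) (at x)"
    by simp
  then have "(flat n has_real_derivative 0) (at x)"
    by (rule has_field_derivative_transform_within_open[of _ _ _ "{..<0}"]) (use less in auto)
  then show ?thesis
    using less by simp
next
  case equal
  \<comment> \<open>At the origin the difference quotient is itself a member of the family, with
    limit 0.\<close>
  have "(\<lambda>h. (flat n (0 + h) - flat n 0) / h) = flat (n + 1)"
    by (auto simp: flat_def fun_eq_iff)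
  then show ?thesis
    using equal flat_tendsto_0[of "n + 1"] by (simp add: DERIV_def)
next
  case greater
  have "((\<lambda>x. (1 / x) ^ n * exp (- (1 / x))) has_real_derivative
      flat (n + 2) x - n * flat (n + 1) x) (at x)"
    using greater
    apply (auto intro!: derivative_eq_intros simp: flat_def)
    apply (cases n)
    apply (auto simp: field_simps power2_eq_square)
    done
  then show ?thesis
    by (rule has_field_derivative_transform_within_open[of _ _ _ "{0<..}"])
      (use greater in \<open>auto simp: flat_def\<close>)
qed

lemma Ck_on_flat: "Ck_on k UNIV (flat n)"
proof (induction k arbitrary: n)
  case 0
  then show ?case
    using DERIV_flat DERIV_isCont continuous_at_imp_continuous_on by (metis Ck_on.simps(1))
next
  case (Suc k)
  show ?case
    unfolding Ck_on_Suc_real_iff[OF thick_UNIV]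
  proof (intro exI conjI ballI)
    show "(flat n has_vector_derivative flat (n + 2) x - n * flat (n + 1) x) (at x)" for x
      using DERIV_flat has_real_derivative_iff_has_vector_derivative by blast
    show "Ck_on k UNIV (\<lambda>x. flat (n + 2) x - real n * flat (n + 1) x)"
      by (intro Ck_on_diff Ck_on_mult Suc.IH thick_UNIV Ck_on_const)
  qed
qed

text \<open>With F = \<open>flat 0\<close> this is 1 - F(F 1 - F x) / F(F 1). For x \<le> 0 the
  inner term F x vanishes; for x \<ge> 1 the outer argument is nonpositive. The denominator is
  constant, so composition alone yields smoothness.\<close>

definition smooth_step :: "real \<Rightarrow> real" where
  "smooth_step x = 1 - flat 0 (flat 0 1 - flat 0 x) / flat 0 (flat 0 1)"

lemma smooth_step_nonpos: "x \<le> 0 \<Longrightarrow> smooth_step x = 0"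
  using flat_pos[of "flat 0 1" 0] flat_pos[of 1 0] by (simp add: smooth_step_def)

lemma smooth_step_ge_1: "x \<ge> 1 \<Longrightarrow> smooth_step x = 1"
  using flat_0_mono[of 1 x] by (simp add: smooth_step_def)

lemma smooth_step_bounds: "0 \<le> smooth_step x" "smooth_step x \<le> 1"
proof -
  have "flat 0 (flat 0 1) > 0"
    by (simp add: flat_pos)
  moreover have "flat 0 (flat 0 1 - flat 0 x) \<le> flat 0 (flat 0 1)"
    using flat_nonneg[of 0 x] by (intro flat_0_mono) simp
  ultimately show "0 \<le> smooth_step x" "smooth_step x \<le> 1"
    using flat_nonneg by (auto simp: smooth_step_def)
qed

lemma Ck_on_smooth_step: "Ck_on k UNIV smooth_step"
proof -
  have "Ck_on k UNIV (\<lambda>x. 1 - flat 0 (flat 0 1 - flat 0 x) * inverse (flat 0 (flat 0 1)))"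
    by (intro Ck_on_diff Ck_on_mult Ck_on_const thick_UNIV Ck_on_flat
        Ck_on_compose_UNIV[OF thick_UNIV Ck_on_flat])
  then show ?thesis
    by (simp add: smooth_step_def[abs_def] divide_inverse)
qed

text \<open>A bump equal to 1 for \<bar>x\<bar> \<le> d/2 and to 0 for \<bar>x\<bar> \<ge> d.
  Squaring x avoids the absolute value, which is not smooth at 0.\<close>

definition plateau :: "real \<Rightarrow> real \<Rightarrow> real" where
  "plateau d x = smooth_step (2 - 2 * (x * x) / d\<^sup>2)"

lemma plateau_outside:
  assumes "d > 0" "\<bar>x\<bar> \<ge> d"
  shows "plateau d x = 0"
proof -
  have "d\<^sup>2 \<le> x * x"
    using assms abs_le_square_iff[of d x] by (simp add: power2_eq_square)
  then have "2 * (x * x) / d\<^sup>2 \<ge> 2"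
    using assms by (simp add: field_simps)
  then show ?thesis
    by (simp add: plateau_def smooth_step_nonpos)
qed

lemma plateau_inside:
  assumes "d > 0" "\<bar>x\<bar> \<le> d / 2"
  shows "plateau d x = 1"
proof -
  have "x * x \<le> (d / 2)\<^sup>2"
    using assms abs_le_square_iff[of x "d / 2"] by (simp add: power2_eq_square)
  then have "4 * (x * x) \<le> d\<^sup>2"
    by (simp add: power2_eq_square)
  then have "2 * (x * x) / d\<^sup>2 \<le> 1"
    using assms zero_le_square[of x] by (simp only: divide_le_eq_1 zero_less_power2) linarith
  then show ?thesis
    by (simp add: plateau_def smooth_step_ge_1)
qed

lemma plateau_bounds: "0 \<le> plateau d x" "plateau d x \<le> 1"
  by (simp_all add: plateau_def smooth_step_bounds)

lemma Ck_on_plateau: "Ck_on k UNIV (plateau d)"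
proof -
  have "Ck_on k UNIV (\<lambda>x. smooth_step (2 - 2 / d\<^sup>2 * (x * x)))"
    by (intro Ck_on_compose_UNIV[OF thick_UNIV Ck_on_smooth_step] Ck_on_diff Ck_on_mult
        Ck_on_const thick_UNIV Ck_on_ident)
  then show ?thesis
    by (simp add: plateau_def[abs_def])
qed

lemma plateau_Lipschitz:
  assumes "d > 0"
  obtains L where "L > 0" "\<And>x y. \<bar>plateau d x - plateau d y\<bar> \<le> L * \<bar>x - y\<bar>"
proof -
  obtain D where D: "\<And>x. (plateau d has_vector_derivative D x) (at x)" "continuous_on UNIV D"
    using Ck_on_plateau[of "Suc 0" d] unfolding Ck_on_Suc_real_iff[OF thick_UNIV] by auto
  have "bounded (D ` {-d..d})"
    by (intro compact_imp_bounded compact_continuous_image continuous_on_subset[OF D(2)]) auto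
  then obtain L where L: "L > 0" "\<And>x. x \<in> {-d..d} \<Longrightarrow> \<bar>D x\<bar> \<le> L"
    unfolding bounded_pos by auto
  have lip: "\<bar>plateau d x - plateau d y\<bar> \<le> L * \<bar>x - y\<bar>"
    if "x \<in> {-d..d}" "y \<in> {-d..d}" for x y
    using field_differentiable_bound[of "{-d..d}" "plateau d" D L x y] that L D(1)
    by (auto simp: has_real_derivative_iff_has_vector_derivative has_vector_derivative_at_within)
  \<comment> \<open>The function vanishes from \<bar>x\<bar> = d outwards, so clamping the argument
    to [-d, d] changes nothing. Clamping does not increase distances, so the Lipschitz bound on the
    interval becomes global.\<close>
  have clamp: "plateau d x = plateau d (max (-d) (min d x))" for x
    using assms plateau_outside[of d x] plateau_outside[of d d] plateau_outside[of d "-d"]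
    by (auto simp: max_def min_def abs_if)
  show ?thesis
  proof (rule that[OF L(1)])
    fix x y
    have "\<bar>plateau d x - plateau d y\<bar> \<le> L * \<bar>max (-d) (min d x) - max (-d) (min d y)\<bar>"
      unfolding clamp[of x] clamp[of y] using assms by (intro lip) auto
    also have "\<dots> \<le> L * \<bar>x - y\<bar>"
      using L(1) by (intro mult_left_mono) (auto simp: max_def min_def abs_if)
    finally show "\<bar>plateau d x - plateau d y\<bar> \<le> L * \<bar>x - y\<bar>" .
  qed
qed

text \<open>Each function differentiates into the other up to sign, so the two claims are proved in
  one induction.\<close>

lemma Ck_on_sin_cos: "Ck_on k UNIV (sin :: real \<Rightarrow> real) \<and> Ck_on k UNIV (cos :: real \<Rightarrow> real)"
proof (induction k)
  case 0
  then show ?case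
    by (auto intro!: continuous_intros)
next
  case (Suc k)
  have "(sin has_vector_derivative cos x) (at x)" "(cos has_vector_derivative - sin x) (at x)"
    for x :: real
    by (auto simp flip: has_real_derivative_iff_has_vector_derivative intro!: derivative_eq_intros)
  moreover have "Ck_on k UNIV (cos :: real \<Rightarrow> real)" "Ck_on k UNIV (\<lambda>x::real. - sin x)"
    using Suc Ck_on_minus[OF thick_UNIV, of k "sin :: real \<Rightarrow> real"] by simp_all
  ultimately show ?case
    unfolding Ck_on_Suc_real_iff[OF thick_UNIV]
    by (intro conjI exI[of _ cos] exI[of _ "\<lambda>x. - sin x"]) simp_all
qed

section \<open>Shears, local graphs and planar annuli\<close>

text \<open>A slice preserves every vertical line and there subtracts a term with Lipschitz constant
  at most \<open>K * L\<close> < 1, hence is injective. As this term is bounded, the intermediate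
  value theorem gives surjectivity.\<close>

lemma isotopy_shear:
  fixes \<psi> \<zeta> :: "real \<Rightarrow> real"
  assumes \<psi>: "Ck_on 3 UNIV \<psi>" "\<And>x. \<bar>\<psi> x\<bar> \<le> K"
    and \<zeta>: "Ck_on 3 UNIV \<zeta>" "\<And>z. \<bar>\<zeta> z\<bar> \<le> 1" "\<And>y z. \<bar>\<zeta> y - \<zeta> z\<bar> \<le> L * \<bar>y - z\<bar>"
    and KL: "K * L < 1"
  shows "isotopy (\<lambda>(t, x, z). (x, z - t * \<psi> x * \<zeta> z))"
proof -
  let ?a = "\<lambda>(t, x, z). (x, z - t * \<psi> x * \<zeta> z)"
  have th: "thick ({0..1::real} \<times> (UNIV :: (real \<times> real) set))"
    by (simp add: thick_Times thick_Icc)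
  let ?S = "{0..1::real} \<times> (UNIV :: (real \<times> real) set)"
  have c: "Ck_on 3 ?S fst" "Ck_on 3 ?S (\<lambda>q. fst (snd q))" "Ck_on 3 ?S (\<lambda>q. snd (snd q))"
    by (rule Ck_on_bounded_linear[OF th bounded_linear_fst]
        Ck_on_bounded_linear[OF th bounded_linear_compose[OF bounded_linear_fst bounded_linear_snd]]
        Ck_on_bounded_linear[OF th bounded_linear_compose[OF bounded_linear_snd bounded_linear_snd]])+
  have "Ck_on 3 ?S (\<lambda>q. (fst (snd q), snd (snd q) - fst q * \<psi> (fst (snd q)) * \<zeta> (snd (snd q))))"
    by (intro Ck_on_Pair Ck_on_diff Ck_on_mult th Ck_on_compose_UNIV[OF th \<psi>(1)]
        Ck_on_compose_UNIV[OF th \<zeta>(1)] c)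
  then have joint: "Ck_on 3 ?S ?a"
    by (simp add: case_prod_unfold)
  have slice: "Ck_on 3 UNIV (\<lambda>p. ?a (t, p))" for t
  proof -
    have "Ck_on 3 UNIV (\<lambda>p::real \<times> real. (fst p, snd p - t * \<psi> (fst p) * \<zeta> (snd p)))"
      by (intro Ck_on_Pair Ck_on_diff Ck_on_mult thick_UNIV Ck_on_const
          Ck_on_compose_UNIV[OF thick_UNIV \<psi>(1)] Ck_on_compose_UNIV[OF thick_UNIV \<zeta>(1)]
          Ck_on_bounded_linear[OF thick_UNIV bounded_linear_fst]
          Ck_on_bounded_linear[OF thick_UNIV bounded_linear_snd])
    then show ?thesis
      by (simp add: case_prod_unfold)
  qed
  have homeo: "\<exists>g. homeomorphism UNIV UNIV (\<lambda>p. ?a (t, p)) g" if t: "t \<in> {0..1}" for t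
  proof -
    have tK: "\<bar>t * \<psi> x\<bar> \<le> K" for x
      using mult_mono[OF _ \<psi>(2)[of x], of "\<bar>t\<bar>" 1] t by (simp add: abs_mult)
    have inj: "z = z'" if "z - t * \<psi> x * \<zeta> z = z' - t * \<psi> x * \<zeta> z'" for x z z'
    proof (rule ccontr)
      assume ne: "z \<noteq> z'"
      have "\<bar>z - z'\<bar> = \<bar>t * \<psi> x * (\<zeta> z - \<zeta> z')\<bar>"
        using that by (simp add: algebra_simps)
      also have "\<dots> \<le> K * (L * \<bar>z - z'\<bar>)"
        unfolding abs_mult[of "t * \<psi> x"] using tK[of x] \<zeta>(3) by (intro mult_mono) auto
      also have "\<dots> < 1 * \<bar>z - z'\<bar>"
        unfolding mult.assoc[symmetric] using KL ne by (intro mult_strict_right_mono) auto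
      finally show False
        by simp
    qed
    have surj: "\<exists>z. z - t * \<psi> x * \<zeta> z = y" for x y
    proof -
      have b: "\<bar>t * \<psi> x * \<zeta> z\<bar> \<le> K" for z
        unfolding abs_mult[of "t * \<psi> x"] using mult_mono[OF tK[of x] \<zeta>(2)[of z]] tK[of x] by simp
      \<comment> \<open>The subtracted term has size at most K, so the values at y - K and y + K
        bracket y.\<close>
      have "continuous_on {y - K..y + K} (\<lambda>z. z - t * \<psi> x * \<zeta> z)"
        using Ck_on_imp_continuous_on[OF \<zeta>(1)]
        by (intro continuous_intros) (auto intro: continuous_on_subset)
      moreover have "0 \<le> K" "y - K - t * \<psi> x * \<zeta> (y - K) \<le> y" "y \<le> y + K - t * \<psi> x * \<zeta> (y + K)"
        using b[of "y - K"] b[of "y + K"] by linarith+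
      ultimately obtain z where "z - t * \<psi> x * \<zeta> z = y"
        using IVT'[of "\<lambda>z. z - t * \<psi> x * \<zeta> z" "y - K" y "y + K"] by fastforce
      then show ?thesis ..
    qed
    define f where "f p = ?a (t, p)" for p
    have inj_f: "inj f"
    proof (rule injI)
      fix p p' assume "f p = f p'"
      then have eq: "fst p = fst p'"
        "snd p - t * \<psi> (fst p) * \<zeta> (snd p) = snd p' - t * \<psi> (fst p) * \<zeta> (snd p')"
        unfolding f_def case_prod_unfold by auto
      show "p = p'"
        using eq(1) inj[OF eq(2)] by (rule prod_eqI)
    qed
    have cont_f: "continuous_on UNIV f"
      unfolding f_def[abs_def] by (rule Ck_on_imp_continuous_on[OF slice])
    have "p \<in> range f" for p
    proof -
      obtain z where "z - t * \<psi> (fst p) * \<zeta> z = snd p"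
        using surj by blast
      then have "f (fst p, z) = p"
        by (simp add: f_def)
      then show ?thesis
        by (metis rangeI)
    qed
    then have "range f = UNIV"
      by blast
    \<comment> \<open>Invariance of domain supplies the continuity of the inverse.\<close>
    moreover obtain g where "homeomorphism UNIV (range f) f g"
      by (rule invariance_of_domain_homeomorphism[OF open_UNIV cont_f order_refl inj_f])
    ultimately show ?thesis
      unfolding f_def[abs_def] by auto
  qed
  show ?thesis
    unfolding isotopy_def using joint slice homeo by (simp del: split_paired_All)
qed

text \<open>By continuity r' has no zero near s0, so r is injective there by the mean value theorem.
  The graph function is h composed with the local inverse of r, and it keeps the full order of
  differentiability.\<close>

lemma Ck_curve_local_graph:
  fixes r h :: "real \<Rightarrow> real"
  assumes r: "Ck_on (Suc k) UNIV r" and h: "Ck_on (Suc k) UNIV h"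
    and D: "(r has_real_derivative D) (at s0)" "D \<noteq> 0"
  obtains e J g where "e > 0" "open J" "Ck_on (Suc k) J g"
    "\<And>s. \<bar>s - s0\<bar> < e \<Longrightarrow> r s \<in> J \<and> g (r s) = h s"
proof -
  obtain r' where r': "\<And>s. (r has_real_derivative r' s) (at s)" "Ck_on k UNIV r'"
    using r unfolding Ck_on_Suc_real_iff[OF thick_UNIV]
    by (auto simp: has_real_derivative_iff_has_vector_derivative)
  have "r' s0 \<noteq> 0"
    using D r'(1) DERIV_unique by metis
  moreover have "isCont r' s0"
    using Ck_on_imp_continuous_on[OF r'(2)] by (simp add: continuous_on_eq_continuous_at)
  ultimately obtain e where e: "e > 0" "\<And>s. \<bar>s - s0\<bar> < e \<Longrightarrow> r' s \<noteq> 0"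
    using continuous_at_avoid[of s0 r' 0] by (auto simp: dist_real_def abs_minus_commute)
  let ?S = "ball s0 e"
  have ne: "r' s \<noteq> 0" if "s \<in> ?S" for s
    using that e by (auto simp: dist_real_def abs_minus_commute)
  have neq: "r s \<noteq> r u" if su: "s \<in> ?S" "u \<in> ?S" "s < u" for s u
  proof
    assume eq: "r s = r u"
    obtain v where v: "s < v" "v < u" "r u - r s = (u - s) * r' v"
      using MVT2[OF su(3)] r'(1) by blast
    then have "v \<in> ?S"
      using su by (auto simp: dist_real_def)
    then show False
      using v eq ne su(3) by simp
  qed
  have inj: "inj_on r ?S"
    by (rule linorder_inj_onI) (use neq in auto)
  have cont: "continuous_on ?S r"
    using Ck_on_imp_continuous_on[OF r] continuous_on_subset by blast
  define J where "J = r ` ?S"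
  define q where "q = inv_into ?S r"
  have q: "q (r s) = s" if "s \<in> ?S" for s
    using that inj by (simp add: q_def)
  have J: "open J"
    unfolding J_def by (rule invariance_of_domain[OF cont _ inj]) simp
  have "Ck_on (Suc k) J q"
  proof (rule Ck_on_inverse_function[where S = ?S and f = r and f' = r'])
    show "Ck_on (Suc k) ?S r"
      using r by (rule Ck_on_subset) (auto intro: thick_open)
    show "continuous_on J q"
      unfolding J_def using continuous_on_inverse_open[of ?S r q] cont q by simp
  qed (use J r' ne q in \<open>auto simp: J_def\<close>)
  then have "Ck_on (Suc k) J (\<lambda>x. h (q x))"
    using J by (intro Ck_on_compose[OF _ thick_UNIV h]) (auto intro: thick_open simp del: Ck_on.simps)
  then show ?thesis
    using e(1) J q by (intro that[of e J "\<lambda>x. h (q x)"])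
      (auto simp: J_def dist_real_def abs_minus_commute simp del: Ck_on.simps)
qed

text \<open>The condition cos (s - s0) > cos d describes the arc of half-width d around s0 modulo 2
  pi, so periodicity is built in. Plain differentiability of the curve lets the lemma apply after a
  shear that is only C^3.\<close>

lemma surf_rev_nontrivial_deformation:
  fixes \<mu> :: "real \<Rightarrow> real \<times> real"
  assumes r: "\<And>s. (\<lambda>s. fst (\<mu> s)) differentiable (at s)"
    and h: "\<And>s. (\<lambda>s. snd (\<mu> s)) differentiable (at s)"
    and pos: "\<And>s. fst (\<mu> s) > 0"
    and d: "0 < d" "d < pi"
    and const: "\<And>s. cos (s - s0) > cos d \<Longrightarrow> snd (\<mu> s) = c"
  shows "\<exists>Z. inf_deformation (surf_rev \<mu>) Z \<and> \<not> trivial_deformation (surf_rev \<mu>) Z"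
proof -
  define \<phi> where "\<phi> s = flat 0 (cos (s - s0) - cos d)" for s
  define \<phi>' where "\<phi>' s = - (flat 2 (cos (s - s0) - cos d) * sin (s - s0))" for s
  define Z :: "real \<times> real \<Rightarrow> real^3" where "Z p = \<phi> (fst p) *\<^sub>R axis 3 1" for p
  let ?F = "surf_rev \<mu>"
  have F: "?F = (\<lambda>p. (fst (\<mu> (fst p)) * cos (snd p)) *\<^sub>R axis 1 1
      + (fst (\<mu> (fst p)) * sin (snd p)) *\<^sub>R axis 2 1 + snd (\<mu> (fst p)) *\<^sub>R axis 3 1)"
    by (auto simp: surf_rev_def fun_eq_iff vec_eq_iff forall_3 axis_def)
  have smooth: "smooth_on UNIV Z"
    unfolding smooth_on_def
  proof
    fix k
    have "Ck_on k UNIV \<phi>"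
      unfolding \<phi>_def[abs_def]
      by (intro Ck_on_compose_UNIV[OF thick_UNIV Ck_on_flat] Ck_on_diff thick_UNIV Ck_on_const
          Ck_on_compose_UNIV[OF thick_UNIV conjunct2[OF Ck_on_sin_cos]] Ck_on_ident)
    then have "Ck_on k UNIV (\<lambda>p::real \<times> real. \<phi> (fst p))"
      by (rule Ck_on_compose_UNIV[OF thick_UNIV _ Ck_on_bounded_linear[OF thick_UNIV bounded_linear_fst]])
    then show "Ck_on k UNIV Z"
      unfolding Z_def[abs_def]
      by (intro Ck_on_bounded_linear_compose[OF thick_UNIV bounded_linear_scaleR_left])
  qed
  have \<phi>: "(\<phi> has_real_derivative \<phi>' s) (at s)" for s
    unfolding \<phi>_def[abs_def] \<phi>'_def
    by (rule DERIV_chain2[OF DERIV_flat, THEN DERIV_cong])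
      (auto intro!: derivative_eq_intros simp: numeral_2_eq_2)
  have dZ: "(Z has_derivative (\<lambda>X. (\<phi>' (fst p) * fst X) *\<^sub>R axis 3 1)) (at p)" for p
  proof -
    have "((\<lambda>p. \<phi> (fst p)) has_derivative (\<lambda>X. \<phi>' (fst p) * fst X)) (at p)"
      using has_derivative_compose[OF has_derivative_fst[OF has_derivative_ident], of \<phi> "(*) (\<phi>' (fst p))" p UNIV]
        \<phi>[of "fst p"] by (simp add: has_field_derivative_def)
    then show ?thesis
      unfolding Z_def[abs_def] by (rule has_derivative_scaleR_left)
  qed
  have dF3: "frechet_derivative ?F (at p) X $ 3 = 0" if U: "cos (fst p - s0) > cos d" for p X
  proof -
    have fst_diff: "(\<lambda>p. f (fst p)) differentiable (at p)" if "f differentiable (at (fst p))"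
      for f :: "real \<Rightarrow> real"
      using differentiable_compose[of f fst p UNIV] that bounded_linear_fst
        bounded_linear_imp_differentiable by blast
    have snd_diff: "(\<lambda>p. f (snd p)) differentiable (at p)" if "f differentiable (at (snd p))"
      for f :: "real \<Rightarrow> real"
      using differentiable_compose[of f snd p UNIV] that bounded_linear_snd
        bounded_linear_imp_differentiable by blast
    have sc: "sin differentiable (at x)" "cos differentiable (at x)" for x :: real
      using DERIV_sin DERIV_cos real_differentiable_def by blast+
    have "?F differentiable (at p)"
      unfolding F by (intro derivative_intros fst_diff snd_diff r h sc)
    then have "(?F has_derivative frechet_derivative ?F (at p)) (at p)"
      by (simp add: frechet_derivative_works)
    then have "((\<lambda>p. ?F p $ 3) has_derivative (\<lambda>X. frechet_derivative ?F (at p) X $ 3)) (at p)"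
      by (rule bounded_linear.has_derivative[OF bounded_linear_vec_nth])
    \<comment> \<open>Over the open arc the height is the constant c, so uniqueness of the
      derivative makes the third component vanish.\<close>
    moreover have "((\<lambda>p. ?F p $ 3) has_derivative (\<lambda>X. 0)) (at p)"
    proof (rule has_derivative_transform_within_open)
      show "open {q :: real \<times> real. cos (fst q - s0) > cos d}"
        by (intro open_Collect_less continuous_intros)
      show "((\<lambda>q. c) has_derivative (\<lambda>X. 0)) (at p)"
        by simp
      show "c = ?F q $ 3" if "q \<in> {q. cos (fst q - s0) > cos d}" for q
        using const[of "fst q"] that by (simp add: surf_rev_def case_prod_unfold)
    qed (use U in simp)
    ultimately show ?thesis
      using has_derivative_unique by metis
  qed
  have "frechet_derivative Z (at p) X \<bullet> frechet_derivative ?F (at p) X = 0" for p X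
  proof -
    have "frechet_derivative Z (at p) X = (\<phi>' (fst p) * fst X) *\<^sub>R axis 3 1"
      using frechet_derivative_at[OF dZ] by metis
    \<comment> \<open>Off the arc the argument of \<open>flat 2\<close> is nonpositive and \<phi>'
      vanishes; over the arc the differential of the surface is horizontal.\<close>
    moreover have "\<phi>' (fst p) = 0 \<or> frechet_derivative ?F (at p) X $ 3 = 0"
      using dF3[of p X] by (cases "cos (fst p - s0) > cos d") (auto simp: \<phi>'_def)
    ultimately show ?thesis
      by (auto simp: inner_axis')
  qed
  then have "inf_deformation ?F Z"
    unfolding inf_deformation_def using smooth cos_periodic[of "_ - s0"]
    by (simp add: Z_def \<phi>_def diff_add_eq)
  moreover have "\<not> trivial_deformation ?F Z"
    unfolding trivial_deformation_def
  proof
    assume "\<exists>m w. \<forall>p. Z p = cross3 m (?F p) + w"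
    then obtain m w where mw: "\<And>p. Z p = cross3 m (?F p) + w"
      by blast
    \<comment> \<open>The parameter opposite to s0 lies off the arc, since cos pi = -1. Hence Z
      vanishes on the whole circle of latitude there, whose radius is \<rho>.\<close>
    define \<rho> where "\<rho> = fst (\<mu> (s0 + pi))"
    have \<rho>: "\<rho> > 0"
      by (simp add: \<rho>_def pos)
    have "Z (s0 + pi, t) = 0" for t
      by (simp add: Z_def \<phi>_def)
    then have zero: "cross3 m (?F (s0 + pi, t)) + w = 0" for t
      using mw by metis
    \<comment> \<open>Subtracting the equations at opposite points of the circle eliminates w and
      shows that m has zero cross product with both horizontal axis directions.\<close>
    have m: "m = 0"
      using zero[of 0] zero[of "pi / 2"] zero[of pi] zero[of "- (pi / 2)"] \<rho>
      by (auto simp: surf_rev_def \<rho>_def[symmetric] cross3_def vec_eq_iff forall_3)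
    then have "w = 0"
      using zero[of 0] by simp
    then have "Z (s0, 0) = 0"
      using mw m by simp
    moreover have "cos d < 1"
      using d cos_monotone_0_pi[of 0 d] by simp
    ultimately show False
      using flat_pos[of "1 - cos d" 0] by (simp add: Z_def \<phi>_def vec_eq_iff forall_3 axis_def)
  qed
  ultimately show ?thesis
    by blast
qed

section \<open>Flattening an arc of the generating curve\<close>

theorem mainTheorem1:
  fixes l :: "real \<Rightarrow> real \<times> real" and B :: "(real \<times> real) set"
  assumes "smooth_embedding_S1 l"
    and "\<forall>s. fst (l s) > 0"
    and "compact B"
    and "l ` UNIV \<subseteq> interior B"
  shows "\<exists>a. admissible_perturbation a (l ` UNIV) \<and> support_isotopy a \<subseteq> B \<and>
           (\<exists>Z. inf_deformation (surf_rev ((\<lambda>p. a (1,p)) \<circ> l)) Z \<and>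
                \<not> trivial_deformation (surf_rev ((\<lambda>p. a (1,p)) \<circ> l)) Z)"
proof -

  \<comment> \<open>A critical point of the height and the local graph\<close>
  define r where "r s = fst (l s)" for s
  define h where "h s = snd (l s)" for s
  have lC: "Ck_on k UNIV l" for k
    using assms(1) by (simp add: smooth_embedding_S1_def smooth_on_def)
  have rC: "Ck_on k UNIV r" and hC: "Ck_on k UNIV h" for k
    unfolding r_def[abs_def] h_def[abs_def]
    by (rule Ck_on_bounded_linear_compose[OF thick_UNIV _ lC], rule bounded_linear_fst bounded_linear_snd)+
  have dl: "(l has_derivative frechet_derivative l (at s)) (at s)" for s
    using lC[of "Suc 0"] by (simp add: frechet_derivative_works)
  have dr: "(r has_real_derivative fst (frechet_derivative l (at s) 1)) (at s)"
    and dh: "(h has_real_derivative snd (frechet_derivative l (at s) 1)) (at s)" for s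
  proof -
    have lin: "frechet_derivative l (at s) x = x *\<^sub>R frechet_derivative l (at s) 1" for x
      using linear_scale[OF has_derivative_linear[OF dl], of s x 1] by simp
    have eq: "x * fst (frechet_derivative l (at s) 1) = fst (frechet_derivative l (at s) x)"
      "x * snd (frechet_derivative l (at s) 1) = snd (frechet_derivative l (at s) x)" for x
      unfolding lin[of x] by simp_all
    show "(r has_real_derivative fst (frechet_derivative l (at s) 1)) (at s)"
      "(h has_real_derivative snd (frechet_derivative l (at s) 1)) (at s)"
      unfolding r_def[abs_def] h_def[abs_def]
      using has_derivative_fst[OF dl, of s] has_derivative_snd[OF dl, of s]
      by (auto intro: has_derivative_imp_has_field_derivative eq)
  qed
  obtain s0 where "(h has_real_derivative 0) (at s0)"
  proof -
    have "h (2 * pi) = h 0"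
      using assms(1) unfolding smooth_embedding_S1_def h_def by (metis add_0)
    then show ?thesis
      using Rolle[of 0 "2 * pi" h] continuous_on_subset[OF Ck_on_imp_continuous_on[OF hC] subset_UNIV]
        dh real_differentiable_def that by (metis pi_gt_zero mult_pos_pos zero_less_numeral)
  qed
  then have "snd (frechet_derivative l (at s0) 1) = 0"
    using dh DERIV_unique by metis
  moreover have "frechet_derivative l (at s0) 1 \<noteq> 0"
    using assms(1) by (simp add: smooth_embedding_S1_def)
  ultimately have "fst (frechet_derivative l (at s0) 1) \<noteq> 0"
    by (metis prod.collapse zero_prod_def)
  \<comment> \<open>The order \<open>Suc 2\<close> is 3, the regularity required of an
    isotopy.\<close>
  then obtain e J g where e: "e > 0" and J: "open J" and gC: "Ck_on (Suc 2) J g"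
    and g: "\<And>s. \<bar>s - s0\<bar> < e \<Longrightarrow> r s \<in> J \<and> g (r s) = h s"
    using Ck_curve_local_graph[OF rC hC dr] by metis
  define x0 c where "x0 = r s0" and "c = h s0"
  have x0: "x0 \<in> J" "g x0 = c"
    using g[of s0] e by (auto simp: x0_def c_def)

  \<comment> \<open>Choice of the cutoff radii\<close>
  obtain \<rho> where \<rho>: "\<rho> > 0" "\<And>x z. \<bar>x - x0\<bar> \<le> \<rho> \<Longrightarrow> \<bar>z - c\<bar> \<le> \<rho> \<Longrightarrow> (x, z) \<in> B"
  proof -
    have "(x0, c) \<in> interior B"
      using assms(4) by (auto simp: x0_def c_def r_def h_def)
    then obtain u where u: "u > 0" "ball (x0, c) u \<subseteq> B"
      by (meson mem_interior)
    show ?thesis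
    \<comment> \<open>Two coordinate offsets of at most u/3 add up to less than u.\<close>
    proof (rule that[of "u / 3"])
      fix x z assume xz: "\<bar>x - x0\<bar> \<le> u / 3" "\<bar>z - c\<bar> \<le> u / 3"
      have "dist (x0, c) (x, z) \<le> \<bar>x0 - x\<bar> + \<bar>c - z\<bar>"
        by (simp add: dist_Pair_Pair dist_real_def sqrt_sum_squares_le_sum_abs)
      also have "\<dots> < u"
        using xz u(1) by linarith
      finally show "(x, z) \<in> B"
        using u(2) by auto
    qed (use u in simp)
  qed
  obtain L where L: "L > 0" "\<And>x y. \<bar>plateau \<rho> x - plateau \<rho> y\<bar> \<le> L * \<bar>x - y\<bar>"
    using plateau_Lipschitz[OF \<rho>(1)] by blast
  \<comment> \<open>The bound 1 / (2L) on g - c makes the product of the two constants in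
    \<open>isotopy_shear\<close> equal to 1/2.\<close>
  obtain \<delta> where \<delta>: "\<delta> > 0" "\<delta> \<le> \<rho>" "\<And>x. \<bar>x - x0\<bar> \<le> \<delta> \<Longrightarrow> x \<in> J \<and> \<bar>g x - c\<bar> \<le> 1 / (2 * L)"
  proof -
    obtain u where u: "u > 0" "ball x0 u \<subseteq> J"
      using J x0(1) open_contains_ball by blast
    have "isCont g x0"
      using Ck_on_imp_continuous_on[OF gC] J x0(1) continuous_on_eq_continuous_at by blast
    then obtain v where v: "v > 0" "\<And>x. \<bar>x - x0\<bar> < v \<Longrightarrow> \<bar>g x - c\<bar> < 1 / (2 * L)"
      using L(1) x0(2) unfolding continuous_at_eps_delta dist_real_def
      by (metis divide_pos_pos zero_less_one zero_less_numeral mult_pos_pos)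
    show ?thesis
    proof (rule that[of "min \<rho> (min u v / 2)"])
      fix x assume x: "\<bar>x - x0\<bar> \<le> min \<rho> (min u v / 2)"
      then have "x \<in> ball x0 u" "\<bar>x - x0\<bar> < v"
        using u(1) v(1) by (auto simp: dist_real_def abs_minus_commute)
      then show "x \<in> J \<and> \<bar>g x - c\<bar> \<le> 1 / (2 * L)"
        using u(2) v(2)[of x] by auto
    qed (use u v \<rho> in auto)
  qed

  \<comment> \<open>The shear, its regularity and admissibility\<close>
  define \<psi> where "\<psi> x = plateau \<delta> (x - x0) * (g x - c)" for x
  define \<zeta> where "\<zeta> z = plateau \<rho> (z - c)" for z
  define a :: "real \<times> real \<times> real \<Rightarrow> real \<times> real"
    where "a = (\<lambda>(t, x, z). (x, z - t * \<psi> x * \<zeta> z))"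
  have shift: "Ck_on k UNIV (\<lambda>x. plateau u (x - v))" for k u v
    by (intro Ck_on_compose_UNIV[OF thick_UNIV Ck_on_plateau] Ck_on_diff Ck_on_const thick_UNIV Ck_on_ident)
  have \<psi>C: "Ck_on 3 UNIV \<psi>"
  proof -
    \<comment> \<open>Nothing is known about g off J, but the cutoff makes \<psi> vanish on
      \<open>?V\<close>, which together with J covers the line.\<close>
    let ?V = "- {x0 - \<delta>..x0 + \<delta>}"
    have thJ: "thick J" and thV: "thick ?V"
      using J by (auto intro: thick_open)
    have "Ck_on 3 J \<psi>"
      unfolding \<psi>_def[abs_def] using gC
      by (intro Ck_on_mult Ck_on_diff Ck_on_const thJ Ck_on_subset[OF shift]) (auto simp: eval_nat_numeral)
    moreover have "Ck_on 3 ?V \<psi>"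
    proof (rule Ck_on_cong[OF Ck_on_const[OF thV, of 3 0] _ thV])
      show "0 = \<psi> x" if "x \<in> ?V" for x
        using that plateau_outside[OF \<delta>(1), of "x - x0"] by (auto simp: \<psi>_def)
    qed
    moreover have "J \<union> ?V = UNIV"
      using \<delta>(3) by (force simp: abs_le_iff)
    ultimately show ?thesis
      using Ck_on_open_Un[OF J, of ?V 3 \<psi>] by (simp add: open_Compl)
  qed
  have \<psi>_bound: "\<bar>\<psi> x\<bar> \<le> 1 / (2 * L)" for x
  proof (cases "\<bar>x - x0\<bar> \<le> \<delta>")
    case True
    then have "\<bar>plateau \<delta> (x - x0)\<bar> * \<bar>g x - c\<bar> \<le> 1 * (1 / (2 * L))"
      using \<delta>(3) plateau_bounds[of \<delta> "x - x0"] by (intro mult_mono) auto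
    then show ?thesis
      by (simp add: \<psi>_def abs_mult)
  next
    case False
    then show ?thesis
      using L(1) plateau_outside[OF \<delta>(1), of "x - x0"] by (simp add: \<psi>_def)
  qed
  have iso: "isotopy a"
    unfolding a_def
  proof (rule isotopy_shear[OF \<psi>C \<psi>_bound])
    show "Ck_on 3 UNIV \<zeta>"
      unfolding \<zeta>_def[abs_def] by (rule shift)
    show "\<bar>\<zeta> z\<bar> \<le> 1" for z
      using plateau_bounds[of \<rho> "z - c"] by (simp add: \<zeta>_def)
    show "\<bar>\<zeta> y - \<zeta> z\<bar> \<le> L * \<bar>y - z\<bar>" for y z
      using L(2)[of "y - c" "z - c"] by (simp add: \<zeta>_def)
    show "1 / (2 * L) * L < 1"
      using L(1) by simp
  qed
  have fst_a: "fst (a (t, p)) = fst p" for t p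
    by (simp add: a_def case_prod_unfold)
  \<comment> \<open>The shear fixes the first coordinate, so the curve stays in the right half plane
    at all times.\<close>
  have adm: "admissible_perturbation a (l ` UNIV)"
    using iso assms(2) by (auto simp: admissible_perturbation_def right_half_plane_def fst_a)

  \<comment> \<open>The support of the isotopy\<close>
  have supp: "support_isotopy a \<subseteq> B"
  proof -
    let ?R = "{x0 - \<rho>..x0 + \<rho>} \<times> {c - \<rho>..c + \<rho>}"
    have "closed ?R"
      by (intro closed_Times) auto
    \<comment> \<open>A moved point has both cutoffs nonzero, and \<delta> \<le> \<rho> places it in
      the rectangle. Being closed, the rectangle absorbs both closures in the definition of the
      support.\<close>
    moreover have "p \<in> ?R" if "a (t, p) \<noteq> p" for t p
    proof -
      have "\<psi> (fst p) \<noteq> 0" "\<zeta> (snd p) \<noteq> 0"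
        using that by (auto simp: a_def case_prod_unfold prod_eq_iff)
      then have "\<not> \<delta> \<le> \<bar>fst p - x0\<bar>" "\<not> \<rho> \<le> \<bar>snd p - c\<bar>"
        using plateau_outside[OF \<delta>(1)] plateau_outside[OF \<rho>(1)] by (auto simp: \<psi>_def \<zeta>_def)
      then show ?thesis
        using \<delta>(2) by (auto simp: mem_Times_iff abs_le_iff)
    qed
    ultimately have "support_isotopy a \<subseteq> ?R"
      unfolding support_isotopy_def support_map_def
      by (intro closure_minimal UN_least) auto
    also have "?R \<subseteq> B"
      using \<rho>(2) by (auto simp: abs_le_iff)
    finally show ?thesis .
  qed

  \<comment> \<open>The flattened arc and its deformation\<close>
  let ?\<mu> = "(\<lambda>p. a (1, p)) \<circ> l"
  have fst_\<mu>: "fst (?\<mu> s) = r s" and snd_\<mu>: "snd (?\<mu> s) = h s - \<psi> (r s) * \<zeta> (h s)" for s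
    by (simp_all add: a_def case_prod_unfold r_def h_def)
  obtain d where d: "0 < d" "d < pi"
    and near: "\<And>s. \<bar>s - s0\<bar> < d \<Longrightarrow> \<bar>s - s0\<bar> < e \<and> \<bar>r s - x0\<bar> \<le> \<delta> / 2 \<and> \<bar>h s - c\<bar> \<le> \<rho> / 2"
  proof -
    have "isCont r s0" "isCont h s0"
      using dr dh DERIV_isCont by blast+
    then obtain u v where u: "u > 0" "\<And>s. \<bar>s - s0\<bar> < u \<Longrightarrow> \<bar>r s - x0\<bar> < \<delta> / 2"
      and v: "v > 0" "\<And>s. \<bar>s - s0\<bar> < v \<Longrightarrow> \<bar>h s - c\<bar> < \<rho> / 2"
      using \<delta>(1) \<rho>(1) unfolding continuous_at_eps_delta dist_real_def x0_def c_def
      by (metis half_gt_zero)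
    show ?thesis
    \<comment> \<open>The number 3 keeps d below pi; u and v keep the arc where both cutoffs equal
      1, and e keeps it on the graph.\<close>
    proof (rule that[of "min (min u v) (min e 3)"])
      show "\<bar>s - s0\<bar> < e \<and> \<bar>r s - x0\<bar> \<le> \<delta> / 2 \<and> \<bar>h s - c\<bar> \<le> \<rho> / 2"
        if "\<bar>s - s0\<bar> < min (min u v) (min e 3)" for s
        using u(2)[of s] v(2)[of s] that by simp
    qed (use u v e pi_gt3 in auto)
  qed
  \<comment> \<open>Both cutoffs are 1 and g (r s) = h s, so the new height is h s - (h s - c) =
    c.\<close>
  have flat_near: "snd (?\<mu> s) = c" if "\<bar>s - s0\<bar> < d" for s
    using near[OF that] g[of s] plateau_inside[OF \<delta>(1), of "r s - x0"] plateau_inside[OF \<rho>(1), of "h s - c"]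
    unfolding snd_\<mu> by (simp add: \<psi>_def \<zeta>_def)
  have per: "?\<mu> (s + 2 * pi * of_int n) = ?\<mu> s" for s and n :: int
  proof -
    interpret periodic_fun_simple l "2 * pi"
      by standard (use assms(1) in \<open>simp add: smooth_embedding_S1_def\<close>)
    show ?thesis
      using plus_of_int[of s n] by (simp add: mult.commute)
  qed
  have flat_\<mu>: "snd (?\<mu> s) = c" if "cos (s - s0) > cos d" for s
  proof -
    \<comment> \<open>Removing the nearest whole number of periods moves s to a point u with \<bar>u
      - s0\<bar> \<le> pi, where the cosine is monotone in the distance to s0.\<close>
    define n where "n = round ((s - s0) / (2 * pi))"
    define u where "u = s - 2 * pi * of_int n"
    have "\<bar>of_int n - (s - s0) / (2 * pi)\<bar> \<le> 1 / 2"
      unfolding n_def by (rule of_int_round_abs_le)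
    then have "\<bar>(of_int n - (s - s0) / (2 * pi)) * (2 * pi)\<bar> \<le> 1 / 2 * (2 * pi)"
      unfolding abs_mult by (intro mult_mono) auto
    moreover have "(of_int n - (s - s0) / (2 * pi)) * (2 * pi) = - (u - s0)"
      by (simp add: u_def field_simps)
    ultimately have "\<bar>u - s0\<bar> \<le> pi"
      by simp
    moreover have "cos (u - s0) = cos (s - s0)"
      using cos_int_2pin[of n] sin_int_2pin[of n] cos_diff[of "s - s0" "2 * pi * of_int n"]
      by (simp add: u_def algebra_simps)
    \<comment> \<open>If the distance were at least d, the decrease of the cosine on [0, pi] would
      give cos (u - s0) \<le> cos d.\<close>
    ultimately have "\<bar>u - s0\<bar> < d"
      using that d cos_monotone_0_pi_le[of d "\<bar>u - s0\<bar>"] by (auto simp: not_less[symmetric])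
    then show ?thesis
      using flat_near[of u] per[of u n] by (simp add: u_def)
  qed
  have "\<exists>Z. inf_deformation (surf_rev ?\<mu>) Z \<and> \<not> trivial_deformation (surf_rev ?\<mu>) Z"
  proof (rule surf_rev_nontrivial_deformation[OF _ _ _ d flat_\<mu>])
    show "(\<lambda>s. fst (?\<mu> s)) differentiable (at s)" for s
      unfolding fst_\<mu> using dr real_differentiable_def by blast
    have "Ck_on 3 UNIV (\<lambda>s. h s - \<psi> (r s) * \<zeta> (h s))"
      unfolding \<zeta>_def
      by (intro Ck_on_diff Ck_on_mult thick_UNIV hC Ck_on_compose_UNIV[OF thick_UNIV \<psi>C rC]
          Ck_on_compose_UNIV[OF thick_UNIV shift hC])
    then show "(\<lambda>s. snd (?\<mu> s)) differentiable (at s)" for s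
      unfolding snd_\<mu> by (simp add: eval_nat_numeral)
    show "fst (?\<mu> s) > 0" for s
      unfolding fst_\<mu> using assms(2) by (simp add: r_def)
  qed
  then show ?thesis
    using adm supp by blast
qed

end
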